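(* The problem PartitionIntoParityBases requires an exponential number of independence queries. That is, there exist a constant $c>1$ and infinitely many positive integers $n$ such that the following holds: for every deterministic algorithm which, given a finite set $S$, a partition $\mathcal{P}$ of $S$ into two-element subsets, and an independence oracle for a matroid $M=(S,\mathcal{I})$ with $|S|=2r_M(S)$, always correctly decides whether $S$ can be partitioned into two parity bases of $M$, there is an instance with $|S|=n$ on which the algorithm makes at least $c^{n}$ oracle queries.
   Context: A matroid is a pair $M=(S,\mathcal{I})$ with finite ground set $S$ and family $\mathcal{I}\subseteq 2^S$ of independent sets; $r_M(S)$ denotes its rank, and its bases are its maximal independent sets. Given a partition $\mathcal{P}$ of $S$ into two-element subsets, called pairs, a parity set is a subset of $S$ that is a union of pairs, and a parity basis is a basis of $M$ that is a parity set. PartitionIntoParityBases: given a matroid $M=(S,\mathcal{I})$ with $|S|=2r_M(S)$ together with a partition $\mathcal{P}$ of $S$ into pairs, find a partition of $S$ into two parity bases (in decision form: decide whether such a partition exists). Independence oracle model: the algorithm knows $S$ and $\mathcal{P}$, but accesses $M$ only through queries; one query consists of a subset $X\subseteq S$, and the answer is whether $X\in\mathcal{I}$. Only the number of queries is counted. *)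

theory Defs
  imports Complex_Main "HOL-Library.Disjoint_Sets"
begin

locale matroid =
  fixes S :: "'a set" and \<I> :: "'a set set"
  assumes finite_ground: "finite S"
    and indep_subset_ground: "X \<in> \<I> \<Longrightarrow> X \<subseteq> S"
    and indep_empty: "{} \<in> \<I>"
    and indep_downward: "X \<in> \<I> \<Longrightarrow> Y \<subseteq> X \<Longrightarrow> Y \<in> \<I>"
    and indep_augment: "X \<in> \<I> \<Longrightarrow> Y \<in> \<I> \<Longrightarrow> card X < card Y \<Longrightarrow> \<exists>y\<in>Y - X. insert y X \<in> \<I>"

definition rank :: "'a set set \<Rightarrow> 'a set \<Rightarrow> nat" where
  "rank \<I> X = Max {card Y | Y. Y \<in> \<I> \<and> Y \<subseteq> X}"

definition basis :: "'a set set \<Rightarrow> 'a set \<Rightarrow> bool" where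
  "basis \<I> B \<longleftrightarrow> B \<in> \<I> \<and> (\<forall>X\<in>\<I>. B \<subseteq> X \<longrightarrow> X = B)"

definition pairing :: "'a set \<Rightarrow> 'a set set \<Rightarrow> bool" where
  "pairing S P \<longleftrightarrow> partition_on S P \<and> (\<forall>p\<in>P. card p = 2)"

definition parity_set :: "'a set set \<Rightarrow> 'a set \<Rightarrow> bool" where
  "parity_set P X \<longleftrightarrow> (\<exists>Q\<subseteq>P. X = \<Union>Q)"

definition parity_basis :: "'a set set \<Rightarrow> 'a set set \<Rightarrow> 'a set \<Rightarrow> bool" where
  "parity_basis P \<I> B \<longleftrightarrow> basis \<I> B \<and> parity_set P B"

definition pipb_instance :: "'a set \<Rightarrow> 'a set set \<Rightarrow> 'a set set \<Rightarrow> bool" where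
  "pipb_instance S P \<I> \<longleftrightarrow> matroid S \<I> \<and> pairing S P \<and> card S = 2 * rank \<I> S"

definition partitionable_into_parity_bases ::
    "'a set \<Rightarrow> 'a set set \<Rightarrow> 'a set set \<Rightarrow> bool" where
  "partitionable_into_parity_bases S P \<I> \<longleftrightarrow>
     (\<exists>B1 B2. parity_basis P \<I> B1 \<and> parity_basis P \<I> B2 \<and> B1 \<inter> B2 = {} \<and> B1 \<union> B2 = S)"

text \<open>
  A deterministic algorithm in the independence oracle model is an adaptive query strategy: from
  the ground set, the pairs and the queries answered so far (oldest first) it determines whether to
  query the oracle again or to halt with an answer. The independent sets are not among its
  arguments. Computation between queries is unrestricted, as only queries are counted.
\<close>

datatype 'a action = Query "'a set" | Answer bool

type_synonym 'a history = "('a set \<times> bool) list"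

type_synonym 'a algorithm = "'a set \<Rightarrow> 'a set set \<Rightarrow> 'a history \<Rightarrow> 'a action"

inductive reaches :: "'a algorithm \<Rightarrow> 'a set \<Rightarrow> 'a set set \<Rightarrow> 'a set set \<Rightarrow> 'a history \<Rightarrow> bool"
  for A S P \<I> where
  start: "reaches A S P \<I> []"
| query: "reaches A S P \<I> h \<Longrightarrow> A S P h = Query X \<Longrightarrow> X \<subseteq> S \<Longrightarrow>
    reaches A S P \<I> (h @ [(X, X \<in> \<I>)])"

text \<open>
  The run of \<open>A\<close> halts with answer \<open>b\<close> after exactly \<open>q\<close> queries. Both are unique when they exist
  (\<open>halts_with_unique\<close>); a run that does not terminate, or that queries a set outside \<open>S\<close>,
  does not halt in this sense.
\<close>

definition halts_with ::
    "'a algorithm \<Rightarrow> 'a set \<Rightarrow> 'a set set \<Rightarrow> 'a set set \<Rightarrow> bool \<Rightarrow> nat \<Rightarrow> bool" where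
  "halts_with A S P \<I> b q \<longleftrightarrow>
     (\<exists>h. reaches A S P \<I> h \<and> A S P h = Answer b \<and> length h = q)"

definition decides_pipb :: "'a algorithm \<Rightarrow> bool" where
  "decides_pipb A \<longleftrightarrow>
     (\<forall>S P \<I>. pipb_instance S P \<I> \<longrightarrow>
        (\<exists>q. halts_with A S P \<I> (partitionable_into_parity_bases S P \<I>) q))"

lemma reaches_take:
  assumes "reaches A S P \<I> h" "i < length h"
  shows "A S P (take i h) = Query (fst (h ! i)) \<and> snd (h ! i) = (fst (h ! i) \<in> \<I>)"
  using assms by (induction arbitrary: i) (auto simp: nth_append less_Suc_eq)

lemma reaches_prefix:
  assumes "reaches A S P \<I> h" "reaches A S P \<I> h'" "i \<le> length h" "i \<le> length h'"
  shows "take i h = take i h'"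
  using assms(3,4)
proof (induction i)
  case (Suc i)
  then have eq: "take i h = take i h'" and "i < length h" "i < length h'" by simp_all
  with reaches_take[OF assms(1), of i] reaches_take[OF assms(2), of i]
  have "h ! i = h' ! i" by (simp add: prod_eq_iff)
  with eq \<open>i < length h\<close> \<open>i < length h'\<close> show ?case by (simp add: take_Suc_conv_app_nth)
qed simp

lemma halts_with_unique:
  assumes "halts_with A S P \<I> b q" "halts_with A S P \<I> b' q'"
  shows "b = b' \<and> q = q'"
proof -
  have aux: False
    if "reaches A S P \<I> h" "reaches A S P \<I> h'" "A S P h = Answer a" "length h < length h'"
    for h h' a
    using reaches_prefix[OF that(1,2), of "length h"] reaches_take[OF that(2,4)] that(3,4) by simp
  obtain h h' where h: "reaches A S P \<I> h" "A S P h = Answer b" "length h = q"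
    and h': "reaches A S P \<I> h'" "A S P h' = Answer b'" "length h' = q'"
    using assms unfolding halts_with_def by blast
  have "q = q'" using aux[OF h(1) h'(1) h(2)] aux[OF h'(1) h(1) h'(2)] h(3) h'(3) by (metis nat_neq_iff)
  moreover from this have "h = h'" using reaches_prefix[OF h(1) h'(1), of q] h(3) h'(3) by simp
  ultimately show ?thesis using h(2) h'(2) by simp
qed

end

theory Submission
  imports Defs
begin

text \<open>
  The proof is an adversary argument on sparse paving matroids. If \<open>H\<close> is a family of \<open>r\<close>-sets any
  two of which share at most \<open>r - 2\<close> elements, and \<open>r\<close> is positive and smaller than the size of the
  ground set, then declaring exactly the members of \<open>H\<close> dependent among the \<open>r\<close>-sets gives a matroid
  of rank \<open>r\<close> (\<open>matroid_sparse_paving\<close>, \<open>rank_sparse_paving\<close>). The same holds for every subfamily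
  of \<open>H\<close>, so members of \<open>H\<close> can be made independent one by one. Parity sets of equal size form such a family: two distinct ones differ in a
  whole pair on each side (\<open>sparse_half_parity_sets\<close>).

  Take \<open>2 * m\<close> pairs and \<open>r = 2 * m\<close>, and let \<open>H\<close> consist of all parity sets of size \<open>r\<close>. The matroid
  of \<open>H\<close> has no parity basis, so the answer is negative. Removing a set \<open>B\<close> and its complement from
  \<open>H\<close> turns these two sets into parity bases, so the answer becomes positive; yet only a query to \<open>B\<close>
  or to its complement can notice the change (\<open>reaches_if_oracles_agree\<close>). A correct algorithm, run
  on the matroid of \<open>H\<close>, therefore queries a member of each of the complementary pairs of \<open>H\<close>, of
  which there are half as many as the central binomial coefficient \<open>(2 * m) choose m\<close>
  (\<open>half_parity_sets_le_queries\<close>). In terms of \<open>n = 4 * m\<close> this is at least \<open>2 ^ (n / 4)\<close> for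
  large \<open>m\<close>.
\<close>

section \<open>Sparse paving matroids\<close>

definition sparse_family :: "nat \<Rightarrow> 'a set set \<Rightarrow> bool" where
  "sparse_family r H \<longleftrightarrow>
     (\<forall>A\<in>H. card A = r) \<and> (\<forall>A\<in>H. \<forall>B\<in>H. A \<noteq> B \<longrightarrow> card (A \<inter> B) + 2 \<le> r)"

definition sparse_paving :: "'a set \<Rightarrow> nat \<Rightarrow> 'a set set \<Rightarrow> 'a set set" where
  "sparse_paving S r H = {X. X \<subseteq> S \<and> card X \<le> r \<and> X \<notin> H}"

lemma sparse_family_subset: "sparse_family r H \<Longrightarrow> G \<subseteq> H \<Longrightarrow> sparse_family r G"
  unfolding sparse_family_def by blast

text \<open>
  Both extensions contain \<open>X\<close>, so they overlap in \<open>r - 1\<close> elements, which is too many for two members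
  of \<open>H\<close>. This is what makes augmentation to an \<open>r\<close>-set succeed.
\<close>

lemma sparse_family_extension:
  assumes H: "sparse_family r H" and X: "finite X" "Suc (card X) = r"
    and ab: "a \<notin> X" "b \<notin> X" "a \<noteq> b"
  shows "insert a X \<notin> H \<or> insert b X \<notin> H"
proof (rule ccontr)
  assume "\<not> ?thesis"
  then have "insert a X \<in> H" "insert b X \<in> H" by simp_all
  moreover have "insert a X \<noteq> insert b X" using ab by auto
  ultimately have "card (insert a X \<inter> insert b X) + 2 \<le> r"
    using H unfolding sparse_family_def by metis
  moreover have "insert a X \<inter> insert b X = X" using ab by auto
  ultimately show False using X by simp
qed

text \<open>
  Sets with fewer than \<open>r\<close> elements are all independent, so augmentation is in question only from an
  \<open>(r - 1)\<close>-set \<open>X\<close> towards an \<open>r\<close>-set \<open>Y\<close>. With two candidates in \<open>Y - X\<close> one of them works; with a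
  single candidate the extension is \<open>Y\<close> itself.
\<close>

theorem matroid_sparse_paving:
  assumes S: "finite S" and H: "sparse_family r H" and r: "0 < r"
  shows "matroid S (sparse_paving S r H)"
proof
  have small: "X \<in> sparse_paving S r H" if "X \<subseteq> S" "card X < r" for X
    using H that unfolding sparse_family_def sparse_paving_def by auto
  show "finite S" by fact
  show "X \<subseteq> S" if "X \<in> sparse_paving S r H" for X
    using that by (simp add: sparse_paving_def)
  show "{} \<in> sparse_paving S r H" using small r by simp
  show "Y \<in> sparse_paving S r H" if "X \<in> sparse_paving S r H" "Y \<subseteq> X" for X Y
  proof (cases "Y = X")
    case False
    have "X \<subseteq> S" "card X \<le> r" using that(1) by (auto simp: sparse_paving_def)
    moreover have "card Y < card X"
      using False \<open>Y \<subseteq> X\<close> \<open>X \<subseteq> S\<close> S by (meson finite_subset psubsetI psubset_card_mono)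
    ultimately show ?thesis using small \<open>Y \<subseteq> X\<close> by auto
  qed (use that in simp)
  show "\<exists>y\<in>Y - X. insert y X \<in> sparse_paving S r H"
    if XI: "X \<in> sparse_paving S r H" and YI: "Y \<in> sparse_paving S r H" and lt: "card X < card Y"
    for X Y
  proof -
    have X: "X \<subseteq> S" "finite X" and Y: "Y \<subseteq> S" "finite Y" "card Y \<le> r" "Y \<notin> H"
      using XI YI S finite_subset by (auto simp: sparse_paving_def)
    obtain y where y: "y \<in> Y" "y \<notin> X"
      using lt card_mono[OF X(2), of Y] by fastforce
    show ?thesis
    proof (cases "Suc (card X) < r")
      case True
      then have "insert y X \<in> sparse_paving S r H" using small X Y y by auto
      then show ?thesis using y by blast
    next
      case False
      then have cX: "Suc (card X) = r" and cY: "card Y = r" using lt Y by simp_all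
      show ?thesis
      proof (cases "\<exists>z\<in>Y - X. z \<noteq> y")
        case True
        then obtain z where z: "z \<in> Y" "z \<notin> X" "z \<noteq> y" by blast
        have "insert w X \<in> sparse_paving S r H" if "insert w X \<notin> H" "w \<in> Y" "w \<notin> X" for w
          using that X Y cX by (auto simp: sparse_paving_def)
        then show ?thesis
          using sparse_family_extension[OF H X(2) cX, of y z] y z by blast
      next
        case False
        then have "Y \<subseteq> insert y X" by blast
        moreover have "card (insert y X) = card Y" using X y cX cY by simp
        ultimately have "insert y X = Y" using X(2) by (metis card_subset_eq finite_insert)
        then show ?thesis using YI y by auto
      qed
    qed
  qed
qed

text \<open>
  Some \<open>r\<close>-set must lie outside \<open>H\<close>: of two one-element extensions of the same \<open>(r - 1)\<close>-set, at most
  one is in \<open>H\<close>, and \<open>r < card S\<close> leaves room for two.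
\<close>

lemma rank_sparse_paving:
  assumes S: "finite S" and H: "sparse_family r H" and r: "0 < r" "r < card S"
  shows "rank (sparse_paving S r H) S = r"
proof -
  have "r - 1 \<le> card S" using r by simp
  then obtain X where X: "X \<subseteq> S" "card X = r - 1" "finite X"
    by (rule obtain_subset_with_card_n)
  then have cX: "Suc (card X) = r" using r by simp
  have "2 \<le> card (S - X)" using X r by (simp add: card_Diff_subset)
  then obtain W where "W \<subseteq> S - X" "card W = 2"
    by (rule obtain_subset_with_card_n)
  then obtain a b where ab: "a \<in> S - X" "b \<in> S - X" "a \<noteq> b"
    by (auto simp: card_2_iff)
  then obtain w where w: "w \<in> S - X" "insert w X \<notin> H"
    using sparse_family_extension[OF H X(3) cX, of a b] by auto
  define Y where "Y = insert w X"
  have Y: "Y \<in> sparse_paving S r H" "card Y = r"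
    using w X cX by (auto simp: Y_def sparse_paving_def)
  let ?C = "{card Y | Y. Y \<in> sparse_paving S r H \<and> Y \<subseteq> S}"
  have "?C \<subseteq> {..r}" by (auto simp: sparse_paving_def)
  moreover have "r \<in> ?C" using Y by (auto simp: sparse_paving_def)
  ultimately show ?thesis
    unfolding rank_def by (intro Max_eqI) (auto intro: finite_subset)
qed

lemma basis_sparse_paving:
  assumes S: "finite S" and B: "B \<in> sparse_paving S r H" "card B = r"
  shows "basis (sparse_paving S r H) B"
  unfolding basis_def
proof (intro conjI ballI impI)
  fix X assume "X \<in> sparse_paving S r H" and sub: "B \<subseteq> X"
  then have "card X \<le> r" "finite X" using S finite_subset by (auto simp: sparse_paving_def)
  then show "X = B" using card_seteq[OF _ sub] B by simp
qed fact

section \<open>Parity sets\<close>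

definition pair :: "nat \<Rightarrow> nat set" where
  "pair i = {2 * i, 2 * i + 1}"

definition ground :: "nat \<Rightarrow> nat set" where
  "ground k = {..<2 * k}"

definition pairs :: "nat \<Rightarrow> nat set set" where
  "pairs k = pair ` {..<k}"

text \<open>
  The union of the pairs with index in \<open>T\<close> (\<open>spread_eq_UN\<close>), written as a preimage because preimages
  commute with intersections and complements.
\<close>

definition spread :: "nat set \<Rightarrow> nat set" where
  "spread T = {x. x div 2 \<in> T}"

lemma pair_eq: "pair i = {x. x div 2 = i}"
  unfolding pair_def by auto

lemma card_pair: "card (pair i) = 2"
  unfolding pair_def by simp

lemma disjoint_pair: "i \<noteq> j \<Longrightarrow> pair i \<inter> pair j = {}"
  unfolding pair_eq by auto

lemma ground_eq_spread: "ground k = spread {..<k}"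
  unfolding ground_def spread_def by auto

lemma spread_eq_UN: "spread T = (\<Union>i\<in>T. pair i)"
  unfolding pair_eq spread_def by auto

lemma inj_spread: "inj spread"
proof (rule inj_on_inverseI)
  show "(\<lambda>x. x div 2) ` spread T = T" for T
    unfolding spread_def by (force intro: image_eqI[where x = "2 * i" for i])
qed

lemma card_spread: "finite T \<Longrightarrow> card (spread T) = 2 * card T"
  unfolding spread_eq_UN
  by (subst card_UN_disjoint) (use disjoint_pair card_pair in \<open>auto simp: pair_def\<close>)

lemma pairing_pairs: "pairing (ground k) (pairs k)"
proof -
  have "partition_on (ground k) (pairs k)"
  proof (rule partition_onI)
    show "\<Union> (pairs k) = ground k"
      unfolding pairs_def ground_eq_spread spread_eq_UN ..
    show "{} \<notin> pairs k" by (auto simp: pairs_def pair_def)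
    show "disjnt p p'" if p: "p \<in> pairs k" "p' \<in> pairs k" "p \<noteq> p'" for p p'
    proof -
      obtain i j where "p = pair i" "p' = pair j"
        using p by (auto simp: pairs_def)
      then show ?thesis
        using \<open>p \<noteq> p'\<close> disjoint_pair[of i j] by (auto simp: disjnt_def)
    qed
  qed
  then show ?thesis by (auto simp: pairing_def pairs_def card_pair)
qed

lemma parity_set_pairs_iff: "parity_set (pairs k) X \<longleftrightarrow> (\<exists>T\<subseteq>{..<k}. X = spread T)"
  unfolding parity_set_def pairs_def spread_eq_UN by (metis subset_image_iff)

definition half_parity_sets :: "nat \<Rightarrow> nat set set" where
  "half_parity_sets m = spread ` {T. T \<subseteq> {..<2 * m} \<and> card T = m}"

lemma card_half_parity_sets: "card (half_parity_sets m) = (2 * m) choose m"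
  unfolding half_parity_sets_def
  by (simp add: card_image inj_on_subset[OF inj_spread] n_subsets)

lemma half_parity_sets_iff:
  "X \<in> half_parity_sets m \<longleftrightarrow> parity_set (pairs (2 * m)) X \<and> card X = 2 * m"
  unfolding half_parity_sets_def parity_set_pairs_iff
  by (auto simp: card_spread finite_subset[OF _ finite_lessThan])

lemma half_parity_set_subset: "X \<in> half_parity_sets m \<Longrightarrow> X \<subseteq> ground (2 * m)"
  unfolding half_parity_sets_def ground_eq_spread spread_def by auto

lemma half_parity_set_complement:
  assumes "X \<in> half_parity_sets m"
  shows "ground (2 * m) - X \<in> half_parity_sets m"
proof -
  obtain T where T: "T \<subseteq> {..<2 * m}" "card T = m" "X = spread T"
    using assms unfolding half_parity_sets_def by blast
  have "ground (2 * m) - X = spread ({..<2 * m} - T)"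
    unfolding T ground_eq_spread spread_def by auto
  moreover have "card ({..<2 * m} - T) = m"
    using T finite_subset[OF T(1)] by (simp add: card_Diff_subset)
  ultimately show ?thesis unfolding half_parity_sets_def by blast
qed

text \<open>
  Membership in a parity set is decided pair by pair, so two distinct parity sets of the same size
  disagree on whole pairs: each contains a pair that the other misses.
\<close>

lemma sparse_half_parity_sets: "sparse_family (2 * m) (half_parity_sets m)"
  unfolding sparse_family_def
proof (intro conjI ballI impI)
  show "card A = 2 * m" if "A \<in> half_parity_sets m" for A
    using that by (simp add: half_parity_sets_iff)
  fix A B assume "A \<in> half_parity_sets m" "B \<in> half_parity_sets m" "A \<noteq> B"
  then obtain T U where T: "T \<subseteq> {..<2 * m}" "card T = m" "A = spread T"
    and U: "U \<subseteq> {..<2 * m}" "card U = m" "B = spread U" and "T \<noteq> U"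
    unfolding half_parity_sets_def by blast
  have fin: "finite T" "finite U" using T U finite_subset by blast+
  have "\<not> T \<subseteq> U" using card_subset_eq[OF fin(2)] T U \<open>T \<noteq> U\<close> by auto
  then have "card (T \<inter> U) < m"
    using psubset_card_mono[OF fin(1), of "T \<inter> U"] T by blast
  moreover have "A \<inter> B = spread (T \<inter> U)" unfolding T U spread_def by auto
  ultimately show "card (A \<inter> B) + 2 \<le> 2 * m" using fin by (simp add: card_spread)
qed

lemma pipb_instance_sparse_paving:
  assumes "0 < m" "H \<subseteq> half_parity_sets m"
  shows "pipb_instance (ground (2 * m)) (pairs (2 * m)) (sparse_paving (ground (2 * m)) (2 * m) H)"
proof -
  have "finite (ground (2 * m))" "card (ground (2 * m)) = 4 * m" by (simp_all add: ground_def)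
  moreover have "sparse_family (2 * m) H"
    using sparse_family_subset sparse_half_parity_sets assms(2) by blast
  ultimately show ?thesis
    using assms(1) unfolding pipb_instance_def
    by (simp add: matroid_sparse_paving rank_sparse_paving pairing_pairs)
qed

text \<open>
  Two independent sets that cover the ground set must both have size \<open>2 * m\<close>, and no parity set of
  that size is independent here.
\<close>

lemma not_partitionable_half_parity_sets:
  "\<not> partitionable_into_parity_bases (ground (2 * m)) (pairs (2 * m))
       (sparse_paving (ground (2 * m)) (2 * m) (half_parity_sets m))"
proof
  assume "partitionable_into_parity_bases (ground (2 * m)) (pairs (2 * m))
       (sparse_paving (ground (2 * m)) (2 * m) (half_parity_sets m))"
  then obtain B1 B2 where
    "basis (sparse_paving (ground (2 * m)) (2 * m) (half_parity_sets m)) B1"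
    "basis (sparse_paving (ground (2 * m)) (2 * m) (half_parity_sets m)) B2"
    and par: "parity_set (pairs (2 * m)) B1" and un: "B1 \<union> B2 = ground (2 * m)"
    unfolding partitionable_into_parity_bases_def parity_basis_def by metis
  then have B: "B1 \<in> sparse_paving (ground (2 * m)) (2 * m) (half_parity_sets m)"
    "B2 \<in> sparse_paving (ground (2 * m)) (2 * m) (half_parity_sets m)"
    by (simp_all add: basis_def)
  have "card (ground (2 * m)) = 4 * m" by (simp add: ground_def)
  then have "4 * m \<le> card B1 + card B2" using card_Un_le[of B1 B2] un by simp
  then have "card B1 = 2 * m" using B by (simp add: sparse_paving_def)
  then show False using B(1) par by (simp add: sparse_paving_def half_parity_sets_iff)
qed

lemma partitionable_if_complements_independent:
  assumes B: "B \<in> half_parity_sets m" and "B \<notin> H" "ground (2 * m) - B \<notin> H"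
  shows "partitionable_into_parity_bases (ground (2 * m)) (pairs (2 * m))
           (sparse_paving (ground (2 * m)) (2 * m) H)"
proof -
  have "parity_basis (pairs (2 * m)) (sparse_paving (ground (2 * m)) (2 * m) H) X"
    if "X \<in> half_parity_sets m" "X \<notin> H" for X
  proof -
    have "X \<in> sparse_paving (ground (2 * m)) (2 * m) H"
      using that half_parity_set_subset[OF that(1)]
      by (simp add: sparse_paving_def half_parity_sets_iff)
    moreover have "finite (ground (2 * m))" by (simp add: ground_def)
    ultimately show ?thesis
      using \<open>X \<in> half_parity_sets m\<close>
      by (simp add: basis_sparse_paving parity_basis_def half_parity_sets_iff)
  qed
  then show ?thesis
    unfolding partitionable_into_parity_bases_def
    using assms half_parity_set_complement[OF B] half_parity_set_subset[OF B]
    by (intro exI[of _ B] exI[of _ "ground (2 * m) - B"]) auto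
qed

section \<open>The adversary argument\<close>

text \<open>
  The algorithm sees the matroid only through the answers, so two matroids that agree on all sets
  queried in a run cannot be told apart by it.
\<close>

lemma reaches_if_oracles_agree:
  assumes "reaches A S P \<I> h" "\<And>X. X \<in> fst ` set h \<Longrightarrow> X \<in> \<I> \<longleftrightarrow> X \<in> \<J>"
  shows "reaches A S P \<J> h"
  using assms
proof induction
  case (query h X)
  have "reaches A S P \<J> (h @ [(X, X \<in> \<J>)])"
    using query by (intro reaches.query) auto
  moreover have "X \<in> \<I> \<longleftrightarrow> X \<in> \<J>" using query.prems[of X] by simp
  ultimately show ?case by simp
qed (rule reaches.start)

text \<open>
  Each query \<open>X\<close> rules out at most two choices for the set \<open>B\<close> that the adversary makes independent
  together with its complement, namely \<open>X\<close> and the complement of \<open>X\<close>. With too few queries some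
  choice of \<open>B\<close> survives, and the answer given is wrong for it.
\<close>

lemma half_parity_sets_le_queries:
  fixes A :: "nat algorithm"
  assumes A: "decides_pipb A" and m: "0 < m"
    and halt: "halts_with A (ground (2 * m)) (pairs (2 * m))
      (sparse_paving (ground (2 * m)) (2 * m) (half_parity_sets m)) False q"
  shows "(2 * m) choose m \<le> 2 * q"
proof (rule ccontr)
  define S P H where "S = ground (2 * m)" and "P = pairs (2 * m)" and "H = half_parity_sets m"
  assume "\<not> ?thesis"
  then have less: "2 * q < card H" by (simp add: H_def card_half_parity_sets)
  obtain h where h: "reaches A S P (sparse_paving S (2 * m) H) h" "A S P h = Answer False"
    "length h = q"
    using halt unfolding halts_with_def S_def P_def H_def by blast
  define Q where "Q = fst ` set h"
  have "card Q \<le> q"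
    unfolding Q_def using h(3) card_length[of "map fst h"] by simp
  moreover have "card ((\<lambda>X. S - X) ` Q) \<le> card Q"
    unfolding Q_def by (intro card_image_le) simp
  ultimately have "card (Q \<union> (\<lambda>X. S - X) ` Q) < card H"
    using less card_Un_le[of Q "(\<lambda>X. S - X) ` Q"] by linarith
  then have "\<not> H \<subseteq> Q \<union> (\<lambda>X. S - X) ` Q"
    using card_mono[of "Q \<union> (\<lambda>X. S - X) ` Q" H] unfolding Q_def by fastforce
  then obtain B where B: "B \<in> H" "B \<notin> Q" "B \<notin> (\<lambda>X. S - X) ` Q" by blast
  have "S - (S - B) = B" using half_parity_set_subset B(1) unfolding H_def S_def by blast
  then have BQ: "S - B \<notin> Q" using B(3) by (metis imageI)
  define G where "G = H - {B, S - B}"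
  have "pipb_instance S P (sparse_paving S (2 * m) G)"
    using pipb_instance_sparse_paving[OF m] unfolding S_def P_def G_def H_def by blast
  moreover have "partitionable_into_parity_bases S P (sparse_paving S (2 * m) G)"
    using partitionable_if_complements_independent B(1) unfolding S_def P_def G_def H_def by simp
  ultimately obtain q' where "halts_with A S P (sparse_paving S (2 * m) G) True q'"
    using A unfolding decides_pipb_def by metis
  moreover have "reaches A S P (sparse_paving S (2 * m) G) h"
    using h(1)
  proof (rule reaches_if_oracles_agree)
    show "X \<in> sparse_paving S (2 * m) H \<longleftrightarrow> X \<in> sparse_paving S (2 * m) G"
      if "X \<in> fst ` set h" for X
      using that B(2) BQ unfolding Q_def G_def sparse_paving_def by blast
  qed
  then have "halts_with A S P (sparse_paving S (2 * m) G) False q"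
    using h unfolding halts_with_def by blast
  ultimately show False using halts_with_unique by blast
qed

lemma two_power_le_half_central_binomial:
  assumes "4 \<le> m"
  shows "2 * 2 ^ m \<le> (2 * m) choose m"
proof -
  have "4 * m \<le> 2 ^ m" using assms by (induction m rule: dec_induct) auto
  then have "(4 * m) * 2 ^ m \<le> 2 ^ m * 2 ^ m" by (intro mult_right_mono) auto
  also have "\<dots> = 4 ^ m" by (simp flip: power_mult_distrib)
  also have "4 ^ m \<le> 2 * m * ((2 * m) choose m)"
  proof -
    have "real (4 ^ m) \<le> real (2 * m * ((2 * m) choose m))"
      using central_binomial_lower_bound[of m] assms by (simp add: field_simps)
    then show ?thesis by (simp only: of_nat_le_iff)
  qed
  finally have "(2 * m) * (2 * 2 ^ m) \<le> (2 * m) * ((2 * m) choose m)"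
    by (simp add: algebra_simps)
  then show ?thesis using assms by (subst (asm) mult_le_cancel1) simp
qed

theorem theorem4:
  "\<exists>c::real. c > 1 \<and>
     infinite {n::nat. n > 0 \<and>
       (\<forall>A :: nat algorithm. decides_pipb A \<longrightarrow>
          (\<exists>S P \<I> b q. pipb_instance S P \<I> \<and> card S = n \<and>
             halts_with A S P \<I> b q \<and> real q \<ge> c ^ n))}"
proof (intro exI conjI)
  \<comment> \<open>The instances have size \<open>n = 4 * m\<close>, so the lower bound \<open>2 ^ m\<close> on the queries is \<open>c ^ n\<close>.\<close>
  define c :: real where "c = root 4 2"
  show "c > 1" by (simp add: c_def)
  let ?N = "{n::nat. n > 0 \<and>
       (\<forall>A :: nat algorithm. decides_pipb A \<longrightarrow>
          (\<exists>S P \<I> b q. pipb_instance S P \<I> \<and> card S = n \<and>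
             halts_with A S P \<I> b q \<and> real q \<ge> c ^ n))}"
  have "4 * m \<in> ?N" if m: "4 \<le> m" for m
  proof (intro CollectI conjI allI impI)
    show "0 < 4 * m" using m by simp
    fix A :: "nat algorithm"
    assume A: "decides_pipb A"
    define S P \<I> where "S = ground (2 * m)" and "P = pairs (2 * m)"
      and "\<I> = sparse_paving S (2 * m) (half_parity_sets m)"
    have inst: "pipb_instance S P \<I>"
      using pipb_instance_sparse_paving[of m "half_parity_sets m"] m
      unfolding S_def P_def \<I>_def by simp
    obtain q where q: "halts_with A S P \<I> False q"
      using A inst not_partitionable_half_parity_sets[of m]
      unfolding decides_pipb_def S_def P_def \<I>_def by metis
    have "2 * 2 ^ m \<le> 2 * q"
      using two_power_le_half_central_binomial[OF m] half_parity_sets_le_queries[OF A, of m q] q m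
      unfolding S_def P_def \<I>_def by linarith
    then have "2 ^ m \<le> q" by simp
    then have "real (2 ^ m) \<le> real q" by (simp only: of_nat_le_iff)
    moreover have "c ^ (4 * m) = 2 ^ m" by (simp add: c_def power_mult)
    ultimately have "c ^ (4 * m) \<le> real q" by simp
    moreover have "card S = 4 * m" by (simp add: S_def ground_def)
    ultimately show "\<exists>S P \<I> b q. pipb_instance S P \<I> \<and> card S = 4 * m \<and>
             halts_with A S P \<I> b q \<and> real q \<ge> c ^ (4 * m)"
      using inst q by blast
  qed
  then have "(*) 4 ` {4..} \<subseteq> ?N" by blast
  moreover have "infinite ((*) 4 ` {4::nat..})"
    by (subst finite_image_iff) (auto simp: inj_on_def infinite_Ici)
  ultimately show "infinite ?N" by (rule infinite_super)
qed

end
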